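(* For each $d\ge 3$ there exists $\gamma_d>0$ such that for all $\gamma\ge\gamma_d$ the random walk $X=(X_n)_{n\ge 0}$ on $\mathbb{Z}^d$ with parameter $\gamma$, described in the context, is recurrent.
   Context: Let $e_0,\ldots,e_{d-1}$ be the coordinate vectors in $\mathbb{Z}^d$. For $x=(x_0,\ldots,x_{d-1})\in\mathbb{Z}^d$ define $$\varrho(x)=\min\Big\{k: |x_k|=\max_{j=0,\ldots,d-1}|x_j|\Big\}.$$ Fix a parameter $\gamma>0$. The random walk $X$ with parameter $\gamma$ is the Markov chain on $\mathbb{Z}^d$ given by $X_{n+1}=X_n+\xi_{n+1}$ where, conditionally on $X_0,\ldots,X_n$, the step $\xi_{n+1}$ takes each of the two values $\pm e_{\varrho(X_n)}$ with probability $\frac{\gamma}{2(\gamma+d-1)}$, and each of the values $\pm e_k$, for each $k\ne\varrho(X_n)$, with probability $\frac{1}{2(\gamma+d-1)}$. (That is, the maximal coordinate in absolute value is chosen with weight $\gamma$, every other coordinate with weight $1$, and then $+1$ or $-1$, with equal probabilities, is added to the chosen coordinate.) Recurrent is meant in the usual sense for an irreducible countable-state Markov chain: almost surely the chain returns to its starting point infinitely often. *)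

theory Defs
  imports "HOL-Probability.Probability"
begin

section \<open>The law of a discrete-time Markov chain\<close>

text \<open>
  For a transition kernel \<open>K\<close> and a starting point \<open>x\<close>, \<open>chain_law K x\<close> is the law, on the space of
  trajectories \<open>nat \<Rightarrow> 's\<close>, of the Markov chain \<open>X\<^sub>0 = x\<close>, \<open>X\<^sub>n\<^sub>+\<^sub>1 \<sim> K X\<^sub>n\<close>, obtained from the
  Ionescu-Tulcea theorem; the chain itself is the coordinate process.  Its finite-dimensional
  distributions are given in \<open>chain_law_cylinder\<close>, its conditional one-step distributions
  in \<open>chain_law_conditional\<close>.
\<close>

definition history_kernel :: "('s \<Rightarrow> 's pmf) \<Rightarrow> 's \<Rightarrow> nat \<Rightarrow> (nat \<Rightarrow> 's) \<Rightarrow> 's measure" where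
  "history_kernel K x n \<omega> =
     measure_pmf (case n of 0 \<Rightarrow> return_pmf x | Suc m \<Rightarrow> K (\<omega> m))"

definition chain_law :: "('s \<Rightarrow> 's pmf) \<Rightarrow> 's \<Rightarrow> (nat \<Rightarrow> 's) measure" where
  "chain_law K x =
     projective_family.lim UNIV
       (Ionescu_Tulcea.CI (history_kernel K x) (\<lambda>_. count_space UNIV))
       (\<lambda>_. count_space UNIV)"

definition recurrent_on :: "'s set \<Rightarrow> ('s \<Rightarrow> 's pmf) \<Rightarrow> bool" where
  "recurrent_on S K \<longleftrightarrow>
     (\<forall>x\<in>S. AE \<omega> in chain_law K x. \<exists>\<^sub>\<infinity>n. \<omega> n = x)"

lemma Ionescu_Tulcea_history_kernel:
  fixes K :: "'s \<Rightarrow> 's pmf"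
  shows "Ionescu_Tulcea (history_kernel K x) (\<lambda>_. count_space UNIV)"
proof (rule Ionescu_Tulcea.intro)
  fix i
  show "history_kernel K x i \<in> measurable (PiM {0..<i} (\<lambda>_. count_space UNIV))
          (subprob_algebra (count_space UNIV))"
  proof (cases i)
    case 0
    then show ?thesis
      by (auto simp: history_kernel_def[abs_def] space_subprob_algebra
          intro!: measurable_const prob_space_imp_subprob_space measure_pmf.prob_space_axioms)
  next
    case (Suc m)
    have "(\<lambda>\<omega>. \<omega> m) \<in> measurable (PiM {0..<i} (\<lambda>_. count_space UNIV)) (count_space UNIV)"
      by (rule measurable_component_singleton) (simp add: Suc)
    from measurable_compose[OF this measurable_measure_pmf[of K]]
    show ?thesis
      by (simp add: history_kernel_def[abs_def] Suc)
  qed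
next
  fix i :: nat and \<omega> :: "nat \<Rightarrow> 's"
  show "prob_space (history_kernel K x i \<omega>)"
    unfolding history_kernel_def by (rule measure_pmf.prob_space_axioms)
qed

lemma
  fixes K :: "'s \<Rightarrow> 's pmf"
  shows prob_space_chain_law: "prob_space (chain_law K x)"
    and sets_chain_law [measurable_cong]:
      "sets (chain_law K x) = sets (PiM UNIV (\<lambda>_. count_space UNIV))"
    and space_chain_law [simp]: "space (chain_law K x) = UNIV"
    and emeasure_chain_law_cylinder:
      "emeasure (chain_law K x) {\<omega>. \<forall>i\<le>n. \<omega> i = y i} =
         ennreal (indicator {x} (y 0) * (\<Prod>i<n. pmf (K (y i)) (y (Suc i))))"
proof -
  let ?M = "\<lambda>_::nat. count_space (UNIV :: 's set)"
  interpret IT: Ionescu_Tulcea "history_kernel K x" ?M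
    by (rule Ionescu_Tulcea_history_kernel)
  have eq: "chain_law K x = IT.PF.lim"
    by (simp add: chain_law_def)
  show sets: "sets (chain_law K x) = sets (PiM UNIV ?M)"
    by (simp add: eq)
  show space: "space (chain_law K x) = UNIV"
    using sets_eq_imp_space_eq[OF sets] by (simp add: space_PiM)
  define A where "A n = PiE {0..<n} (\<lambda>i. {y i})" for n
  have A_sets [measurable]: "A n \<in> sets (PiM {0..<n} ?M)" for n
    unfolding A_def by (intro sets_PiM_I_finite) auto
  have A_eq: "A n = {restrict y {0..<n}}" for n
    unfolding A_def PiE_singleton[of "restrict y {0..<n}" "{0..<n}", simplified, symmetric]
    by (intro PiE_cong) auto
  define u where "u = (\<lambda>_::nat. undefined :: 's)"
  have u [simp]: "u \<in> space (PiM {0..<0} ?M)"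
    by (simp add: u_def space_PiM)
  have step: "emeasure (IT.C 0 (Suc n) u) (A (Suc n)) =
      emeasure (IT.C 0 n u) (A n) * emeasure (history_kernel K x n y) {y n}" for n
  proof -
    have C_sets: "sets (IT.C 0 n u) = sets (PiM {0..<n} ?M)"
      using IT.sets_C[OF u, of n] by simp
    have C_space: "space (IT.C 0 n u) = space (PiM {0..<n} ?M)"
      by (rule sets_eq_imp_space_eq[OF C_sets])
    have ne: "space (IT.C 0 n u) \<noteq> {}"
      by (simp add: C_space space_PiM PiE_eq_empty_iff)
    have "emeasure (IT.C 0 (Suc n) u) (A (Suc n)) =
        (\<integral>\<^sup>+\<omega>. emeasure (IT.eP n \<omega>) (A (Suc n)) \<partial>IT.C 0 n u)"
      using ne IT.measurable_eP[of n]
      by (simp, subst emeasure_bind[where N="PiM {0..<Suc n} ?M"])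
         (auto simp: measurable_cong_sets[OF C_sets refl])
    also have "\<dots> = (\<integral>\<^sup>+\<omega>. emeasure (history_kernel K x n y) {y n} * indicator (A n) \<omega> \<partial>IT.C 0 n u)"
    proof (rule nn_integral_cong)
      fix \<omega> assume "\<omega> \<in> space (IT.C 0 n u)"
      then have \<omega>: "\<omega> \<in> space (PiM {0..<n} ?M)" by (simp add: C_space)
      have ext: "\<omega> \<in> extensional {0..<n}"
        using \<omega> by (simp add: space_PiM PiE_def)
      have vim: "(\<lambda>r. fun_upd \<omega> n r) -` A (Suc n) \<inter> space (count_space UNIV) =
          (if \<omega> \<in> A n then {y n} else {})"
        using ext by (auto simp: A_def PiE_iff extensional_def split: if_splits)
      have "history_kernel K x n \<omega> = history_kernel K x n y" if "\<omega> \<in> A n"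
        using that by (auto simp: history_kernel_def A_eq split: nat.splits)
      then show "emeasure (IT.eP n \<omega>) (A (Suc n)) =
          emeasure (history_kernel K x n y) {y n} * indicator (A n) \<omega>"
        unfolding IT.emeasure_eP[OF \<omega> A_sets] vim by auto
    qed
    also have "\<dots> = emeasure (IT.C 0 n u) (A n) * emeasure (history_kernel K x n y) {y n}"
      using A_sets[of n] by (subst nn_integral_cmult_indicator) (simp_all add: C_sets mult.commute)
    finally show ?thesis .
  qed
  have base: "emeasure (IT.C 0 0 u) (A 0) = 1"
    by (simp add: A_def u_def PiM_empty)
  have C_A: "emeasure (IT.C 0 (Suc n) u) (A (Suc n)) =
      ennreal (indicator {x} (y 0) * (\<Prod>i<n. pmf (K (y i)) (y (Suc i))))" for n
  proof (induction n)
    case 0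
    have "emeasure (history_kernel K x 0 y) {y 0} = ennreal (indicator {x} (y 0))"
      by (simp add: history_kernel_def emeasure_pmf_single pmf_return indicator_def)
    then show ?case using step[of 0] base by simp
  next
    case (Suc n)
    have "emeasure (history_kernel K x (Suc n) y) {y (Suc n)} = ennreal (pmf (K (y n)) (y (Suc n)))"
      by (simp add: history_kernel_def emeasure_pmf_single)
    then show ?case
      unfolding step[of "Suc n"] Suc.IH
      by (simp add: ennreal_mult[symmetric] prod_nonneg mult_ac)
  qed
  have emb: "{\<omega>. \<forall>i\<le>n. \<omega> i = y i} = IT.PF.emb UNIV {0..<Suc n} (A (Suc n))" for n
    by (auto simp: prod_emb_def A_def PiE_iff space_PiM less_Suc_eq_le)
  have "emeasure (chain_law K x) {\<omega>. \<forall>i\<le>n. \<omega> i = y i} =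
      emeasure (IT.CI {0..<Suc n}) (A (Suc n))"
    unfolding eq emb by (rule IT.lim) auto
  also have "\<dots> = emeasure (IT.C 0 (Suc n) u) (IT.PF.emb {0..<Suc n} {0..<Suc n} (A (Suc n)))"
    unfolding u_def by (rule IT.emeasure_CI) auto
  also have "IT.PF.emb {0..<Suc n} {0..<Suc n} (A (Suc n)) = A (Suc n)"
    using sets.sets_into_space[OF A_sets[of "Suc n"]] by (intro prod_emb_id) (simp add: space_PiM)
  finally show "emeasure (chain_law K x) {\<omega>. \<forall>i\<le>n. \<omega> i = y i} =
         ennreal (indicator {x} (y 0) * (\<Prod>i<n. pmf (K (y i)) (y (Suc i))))"
    unfolding C_A .
  show "prob_space (chain_law K x)"
  proof
    have "emeasure IT.PF.lim (IT.PF.emb UNIV {} {\<lambda>_. undefined}) = 1"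
      using prob_space.emeasure_space_1[OF IT.PF.prob_space_P[of "{}"]]
      by (subst IT.lim) (auto simp: PiM_empty IT.PF.space_P)
    then show "emeasure (chain_law K x) (space (chain_law K x)) = 1"
      by (simp add: space) (simp add: eq prod_emb_def space_PiM vimage_def restrict_def)
  qed
qed

lemma chain_law_cylinder:
  "measure (chain_law K x) {\<omega>. \<forall>i\<le>n. \<omega> i = y i} =
     indicator {x} (y 0) * (\<Prod>i<n. pmf (K (y i)) (y (Suc i)))"
  unfolding measure_def emeasure_chain_law_cylinder
  by (simp add: prod_nonneg)

lemma chain_law_conditional:
  assumes "measure (chain_law K x) {\<omega>. \<forall>i\<le>n. \<omega> i = y i} > 0"
  shows "measure (chain_law K x) {\<omega>. (\<forall>i\<le>n. \<omega> i = y i) \<and> \<omega> (Suc n) = z} /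
           measure (chain_law K x) {\<omega>. \<forall>i\<le>n. \<omega> i = y i} = pmf (K (y n)) z"
proof -
  define y' where "y' = y(Suc n := z)"
  have "{\<omega>. (\<forall>i\<le>n. \<omega> i = y i) \<and> \<omega> (Suc n) = z} = {\<omega>. \<forall>i\<le>Suc n. \<omega> i = y' i}"
    by (auto simp: y'_def le_Suc_eq)
  moreover have "(\<Prod>i<n. pmf (K (y' i)) (y' (Suc i))) = (\<Prod>i<n. pmf (K (y i)) (y (Suc i)))"
    by (intro prod.cong) (auto simp: y'_def)
  ultimately have "measure (chain_law K x) {\<omega>. (\<forall>i\<le>n. \<omega> i = y i) \<and> \<omega> (Suc n) = z} =
      measure (chain_law K x) {\<omega>. \<forall>i\<le>n. \<omega> i = y i} * pmf (K (y n)) z"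
    by (simp only: chain_law_cylinder prod.lessThan_Suc) (simp add: y'_def)
  then show ?thesis
    using assms by simp
qed


section \<open>The walk\<close>

text \<open>Points of \<open>\<int>\<^sup>d\<close> are functions on \<open>nat\<close> that vanish outside of \<open>{..<d}\<close>.\<close>

definition lattice :: "nat \<Rightarrow> (nat \<Rightarrow> int) set" where
  "lattice d = {x. \<forall>k\<ge>d. x k = 0}"

definition max_index :: "nat \<Rightarrow> (nat \<Rightarrow> int) \<Rightarrow> nat" where
  "max_index d x = (LEAST k. k < d \<and> \<bar>x k\<bar> = Max ((\<lambda>j. \<bar>x j\<bar>) ` {..<d}))"

definition coord_weight :: "nat \<Rightarrow> real \<Rightarrow> (nat \<Rightarrow> int) \<Rightarrow> nat \<Rightarrow> real" where
  "coord_weight d \<gamma> x k =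
     (if k < d then (if k = max_index d x then \<gamma> else 1) / (\<gamma> + real d - 1) else 0)"

text \<open>The one-step distribution; see \<open>pmf_walk_kernel\<close> for the explicit probabilities.
  It is meaningful for \<open>\<gamma> > 0\<close> and \<open>d \<ge> 1\<close>, where the weights are a probability vector.\<close>

definition walk_kernel :: "nat \<Rightarrow> real \<Rightarrow> (nat \<Rightarrow> int) \<Rightarrow> (nat \<Rightarrow> int) pmf" where
  "walk_kernel d \<gamma> x =
     map_pmf (\<lambda>(k, s). x(k := x k + s))
       (pair_pmf (embed_pmf (coord_weight d \<gamma> x)) (pmf_of_set {-1, 1}))"

lemma max_index:
  assumes "d > 0"
  shows "max_index d x < d" "\<bar>x (max_index d x)\<bar> = Max ((\<lambda>j. \<bar>x j\<bar>) ` {..<d})"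
proof -
  have "Max ((\<lambda>j. \<bar>x j\<bar>) ` {..<d}) \<in> (\<lambda>j. \<bar>x j\<bar>) ` {..<d}"
    using assms by (intro Max_in) auto
  then have "\<exists>k. k < d \<and> \<bar>x k\<bar> = Max ((\<lambda>j. \<bar>x j\<bar>) ` {..<d})"
    by auto
  from LeastI_ex[OF this]
  show "max_index d x < d" "\<bar>x (max_index d x)\<bar> = Max ((\<lambda>j. \<bar>x j\<bar>) ` {..<d})"
    unfolding max_index_def by auto
qed

lemma pmf_coord_weight:
  assumes "d > 0" "\<gamma> > 0"
  shows "pmf (embed_pmf (coord_weight d \<gamma> x)) k = coord_weight d \<gamma> x k"
proof (rule pmf_embed_pmf)
  have pos: "\<gamma> + real d - 1 > 0" using assms by linarith
  show nn: "0 \<le> coord_weight d \<gamma> x j" for j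
    using assms pos by (auto simp: coord_weight_def)
  let ?m = "max_index d x"
  have m: "?m < d" using assms by (intro max_index)
  have "(\<Sum>j<d. coord_weight d \<gamma> x j) =
      (\<Sum>j<d. if j = ?m then \<gamma> else 1) / (\<gamma> + real d - 1)"
    unfolding sum_divide_distrib by (intro sum.cong) (auto simp: coord_weight_def)
  also have "(\<Sum>j<d. if j = ?m then \<gamma> else 1) = \<gamma> + (\<Sum>j\<in>{..<d} - {?m}. if j = ?m then \<gamma> else 1)"
    using m by (subst sum.remove[of _ ?m]) auto
  also have "(\<Sum>j\<in>{..<d} - {?m}. if j = ?m then \<gamma> else 1) = (\<Sum>j\<in>{..<d} - {?m}. 1)"
    by (intro sum.cong) auto
  also have "\<dots> = real d - 1"
    using m by (simp add: of_nat_diff)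
  finally have sum: "(\<Sum>j<d. coord_weight d \<gamma> x j) = 1"
    using pos by (simp add: add_diff_eq)
  have "(\<integral>\<^sup>+j. ennreal (coord_weight d \<gamma> x j) \<partial>count_space UNIV) =
      (\<integral>\<^sup>+j. ennreal (coord_weight d \<gamma> x j) \<partial>count_space {..<d})"
    by (rule nn_integral_count_space_eq) (auto simp: coord_weight_def)
  also have "\<dots> = ennreal (\<Sum>j<d. coord_weight d \<gamma> x j)"
    by (simp add: nn_integral_count_space_finite sum_ennreal nn)
  finally show "(\<integral>\<^sup>+j. ennreal (coord_weight d \<gamma> x j) \<partial>count_space UNIV) = 1"
    by (simp add: sum)
qed

lemma pmf_walk_kernel:
  assumes "d > 0" "\<gamma> > 0" "k < d" "s \<in> {-1, 1}"
  shows "pmf (walk_kernel d \<gamma> x) (x(k := x k + s)) =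
    (if k = max_index d x then \<gamma> else 1) / (2 * (\<gamma> + real d - 1))"
proof -
  let ?f = "\<lambda>(k, s). x(k := x k + s)"
  let ?p = "pair_pmf (embed_pmf (coord_weight d \<gamma> x)) (pmf_of_set {-1, 1 :: int})"
  have vim: "?f -` {x(k := x k + s)} \<inter> set_pmf ?p = {(k, s)} \<inter> set_pmf ?p"
  proof -
    have "(k', s') = (k, s)" if "x(k' := x k' + s') = x(k := x k + s)" "s' \<in> {-1, 1}" for k' s'
    proof -
      have "k' = k"
        using fun_cong[OF that(1), of k'] that(2) by (auto split: if_splits)
      then show ?thesis
        using fun_cong[OF that(1), of k] by simp
    qed
    then show ?thesis
      by (auto simp: set_pmf_of_set)
  qed
  have "pmf (walk_kernel d \<gamma> x) (x(k := x k + s)) = measure ?p (?f -` {x(k := x k + s)})"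
    by (simp add: walk_kernel_def pmf_map)
  also have "\<dots> = measure ?p {(k, s)}"
    using arg_cong[OF vim, of "measure ?p"] unfolding measure_Int_set_pmf .
  also have "\<dots> = coord_weight d \<gamma> x k / 2"
    using assms by (auto simp: measure_pmf_single pmf_pair pmf_coord_weight)
  finally show ?thesis
    using assms by (simp add: coord_weight_def)
qed

end

theory Submission
  imports Defs
begin

text \<open>
  Where the coordinate \<open>m\<close> is maximal, put
  \<open>g\<^sub>m(x) = \<bar>x\<^sub>m\<bar> / 2 + (\<Sum>k\<noteq>m. sqrt (x\<^sub>k\<^sup>2 + e\<^sup>2 x\<^sub>m\<^sup>2))\<close> with \<open>e\<close> of order \<open>1 / d\<^sup>2\<close>. The weight
  \<open>1 / 2 < 1\<close> makes \<open>g\<^sub>m \<le> g\<^sub>k\<close> whenever \<open>\<bar>x\<^sub>k\<bar> \<le> \<bar>x\<^sub>m\<bar>\<close>, so \<open>V = min\<^sub>m g\<^sub>m\<close> is given by \<open>g\<^sub>m\<close> on the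
  sector of \<open>m\<close>, and it is enough to bound the drift of \<open>ln g\<^sub>m\<close> at points of that sector: steps
  into other sectors only help. By \<open>ln t \<le> t - 1\<close>, the second difference of \<open>ln g\<^sub>m\<close> in a direction is
  at most \<open>(g\<^sub>+ g\<^sub>- - g\<^sub>m\<^sup>2) / g\<^sub>m\<^sup>2\<close>. As \<open>g\<^sub>m\<close> is almost linear in \<open>\<bar>x\<^sub>m\<bar>\<close>, the numerator is at most
  \<open>- 1 / 8\<close> in the direction \<open>m\<close>, and it is bounded by a constant in the other directions. Hence
  \<open>ln V\<close> is superharmonic off a finite set once \<open>\<gamma>\<close> is large, and it tends to infinity.

  Recurrence follows by a maximum principle: if \<open>w(x)\<close> is the probability of never visiting \<open>z\<close> from
  \<open>x\<close>, then \<open>w - \<epsilon> ln V\<close> is subharmonic off a finite set \<open>B\<close> containing \<open>z\<close> and tends to \<open>-\<infinity>\<close>, so it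
  attains its maximum on \<open>B\<close>. Letting \<open>\<epsilon> \<rightarrow> 0\<close>, \<open>w\<close> itself attains its maximum on \<open>B\<close>; being subharmonic
  off \<open>z\<close>, it attains it at \<open>z\<close>, where it vanishes.
\<close>

section \<open>Recurrence from a Lyapunov function\<close>

lemma sets_cylinder:
  "{\<omega>. \<forall>i\<le>n. \<omega> i = y i} \<in> sets (chain_law K x)"
proof -
  have "{\<omega>. \<forall>i\<le>n. \<omega> i = y i} =
      {\<omega>\<in>space (PiM UNIV (\<lambda>_. count_space UNIV)). \<forall>i\<in>{..n}. \<omega> i = y i}"
    by (auto simp: space_PiM)
  also have "\<dots> \<in> sets (PiM UNIV (\<lambda>_. count_space UNIV))"
    by measurable
  finally show ?thesis by (simp add: sets_chain_law)
qed

lemma sets_avoid: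
  "{\<omega>. \<forall>i. P i \<longrightarrow> \<omega> i \<noteq> z} \<in> sets (chain_law K x)"
proof -
  have "{\<omega>. \<forall>i. P i \<longrightarrow> \<omega> i \<noteq> z} =
      {\<omega>\<in>space (PiM UNIV (\<lambda>_. count_space UNIV)). \<forall>i. P i \<longrightarrow> \<omega> i \<noteq> z}"
    by (auto simp: space_PiM)
  also have "\<dots> \<in> sets (PiM UNIV (\<lambda>_. count_space UNIV))"
    by measurable
  finally show ?thesis by (simp add: sets_chain_law)
qed

lemma cylinder_Suc:
  "{\<omega>. \<forall>i\<le>Suc n. \<omega> i = (y(Suc n := s)) i} = {\<omega>. (\<forall>i\<le>n. \<omega> i = y i) \<and> \<omega> (Suc n) = s}"
  by (auto simp: le_Suc_eq)

lemma measure_cylinder_Suc: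
  "measure (chain_law K x) {\<omega>. \<forall>i\<le>Suc n. \<omega> i = (y(Suc n := s)) i} =
     measure (chain_law K x) {\<omega>. \<forall>i\<le>n. \<omega> i = y i} * pmf (K (y n)) s"
proof -
  have "(\<Prod>i<n. pmf (K ((y(Suc n := s)) i)) ((y(Suc n := s)) (Suc i))) =
      (\<Prod>i<n. pmf (K (y i)) (y (Suc i)))"
    by (intro prod.cong) auto
  then show ?thesis
    unfolding chain_law_cylinder by (simp del: fun_upd_apply) simp
qed

text \<open>The cylinders prolonged by a state of the support are disjoint and their masses add up
  to that of the shorter cylinder, so what is left over is null.\<close>

lemma AE_cylinder_step:
  assumes "finite (set_pmf (K (y n)))"
  shows "AE \<omega> in chain_law K x. (\<forall>i\<le>n. \<omega> i = y i) \<longrightarrow> \<omega> (Suc n) \<in> set_pmf (K (y n))"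
proof -
  interpret prob_space "chain_law K x" by (rule prob_space_chain_law)
  let ?C = "{\<omega>. \<forall>i\<le>n. \<omega> i = y i}"
  let ?D = "\<lambda>s. {\<omega>. \<forall>i\<le>Suc n. \<omega> i = (y(Suc n := s)) i}"
  let ?T = "set_pmf (K (y n))"
  have D: "?D s \<in> events" for s by (rule sets_cylinder)
  have U: "(\<Union>s\<in>?T. ?D s) \<in> events" by (intro sets.finite_UN[OF assms] D)
  have "prob (\<Union>s\<in>?T. ?D s) = (\<Sum>s\<in>?T. prob (?D s))"
  proof (rule finite_measure_finite_Union[OF assms])
    show "?D ` ?T \<subseteq> events" using D by blast
    show "disjoint_family_on ?D ?T" unfolding disjoint_family_on_def cylinder_Suc by auto
  qed
  also have "\<dots> = prob ?C * (\<Sum>s\<in>?T. pmf (K (y n)) s)"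
    unfolding measure_cylinder_Suc sum_distrib_left ..
  also have "(\<Sum>s\<in>?T. pmf (K (y n)) s) = 1"
    using assms by (intro sum_pmf_eq_1) auto
  finally have "prob (?C - (\<Union>s\<in>?T. ?D s)) = 0"
    using sets_cylinder[of n y K x] U
    by (subst finite_measure_Diff) (auto simp: cylinder_Suc)
  then have "AE \<omega> in chain_law K x. \<omega> \<notin> ?C - (\<Union>s\<in>?T. ?D s)"
    using sets_cylinder[of n y K x] U prob_eq_0 by blast
  then show ?thesis by eventually_elim (auto simp: cylinder_Suc)
qed

text \<open>The probability of not visiting \<open>z\<close> at the times \<open>1, \<dots>, n\<close>; time \<open>0\<close> does not count.\<close>

fun avoid_prob :: "('s \<Rightarrow> 's pmf) \<Rightarrow> 's \<Rightarrow> nat \<Rightarrow> 's \<Rightarrow> real" where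
  "avoid_prob K z 0 x = 1"
| "avoid_prob K z (Suc n) x =
     measure_pmf.expectation (K x) (\<lambda>y. if y = z then 0 else avoid_prob K z n y)"

section \<open>Avoidance probabilities, the maximum principle and the Lyapunov criterion\<close>

locale locally_finite_chain =
  fixes S :: "'s set" and K :: "'s \<Rightarrow> 's pmf"
  assumes closed: "\<And>x. x \<in> S \<Longrightarrow> set_pmf (K x) \<subseteq> S"
    and finite_step: "\<And>x. x \<in> S \<Longrightarrow> finite (set_pmf (K x))"
begin

lemma integrable_step:
  "x \<in> S \<Longrightarrow> integrable (measure_pmf (K x)) (f :: 's \<Rightarrow> real)"
  by (intro integrable_measure_pmf_finite finite_step)

lemma expectation_step:
  fixes f :: "'s \<Rightarrow> real"
  shows "x \<in> S \<Longrightarrow> measure_pmf.expectation (K x) f = (\<Sum>y\<in>set_pmf (K x). pmf (K x) y * f y)"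
  by (subst integral_measure_pmf[of "set_pmf (K x)"]) (auto simp: finite_step)

lemma expectation_step_mono:
  fixes f g :: "'s \<Rightarrow> real"
  assumes "x \<in> S" "\<And>y. y \<in> S \<Longrightarrow> f y \<le> g y"
  shows "measure_pmf.expectation (K x) f \<le> measure_pmf.expectation (K x) g"
  using assms closed[of x] by (auto simp: expectation_step intro!: sum_mono mult_left_mono)

lemma avoid_prob_bounds:
  "x \<in> S \<Longrightarrow> 0 \<le> avoid_prob K z n x \<and> avoid_prob K z n x \<le> 1"
proof (induction n arbitrary: x)
  case (Suc n)
  have "measure_pmf.expectation (K x) (\<lambda>y. 0) \<le> avoid_prob K z (Suc n) x"
    unfolding avoid_prob.simps using Suc by (intro expectation_step_mono) auto
  moreover have "avoid_prob K z (Suc n) x \<le> measure_pmf.expectation (K x) (\<lambda>y. 1)"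
    unfolding avoid_prob.simps using Suc by (intro expectation_step_mono) auto
  ultimately show ?case by simp
qed auto

lemma avoid_prob_decreasing:
  "x \<in> S \<Longrightarrow> avoid_prob K z (Suc n) x \<le> avoid_prob K z n x"
proof (induction n arbitrary: x)
  case 0
  then show ?case using avoid_prob_bounds[of x z "Suc 0"] by simp
next
  case (Suc n)
  show ?case
    unfolding avoid_prob.simps(2)[of K z "Suc n"] avoid_prob.simps(2)[of K z n x]
    using Suc by (intro expectation_step_mono) auto
qed

text \<open>The Markov property for avoidance, obtained by splitting over the next state. An upper
  bound is enough to produce null sets.\<close>

lemma measure_cylinder_avoid:
  assumes "y n \<in> S"
  shows "measure (chain_law K x)
      ({\<omega>. \<forall>i\<le>n. \<omega> i = y i} \<inter> {\<omega>. \<forall>i. n < i \<and> i \<le> n + l \<longrightarrow> \<omega> i \<noteq> z})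
    \<le> measure (chain_law K x) {\<omega>. \<forall>i\<le>n. \<omega> i = y i} * avoid_prob K z l (y n)"
  using assms
proof (induction l arbitrary: n y)
  case 0
  interpret prob_space "chain_law K x" by (rule prob_space_chain_law)
  show ?case
    unfolding avoid_prob.simps mult_1_right by (intro finite_measure_mono sets_cylinder) auto
next
  case (Suc l)
  interpret prob_space "chain_law K x" by (rule prob_space_chain_law)
  let ?C = "\<lambda>n y. {\<omega>. \<forall>i\<le>n. \<omega> i = y i}"
  let ?A = "\<lambda>n l. {\<omega>. \<forall>i. n < i \<and> i \<le> n + l \<longrightarrow> \<omega> i \<noteq> z}"
  let ?T = "set_pmf (K (y n))"
  let ?y = "\<lambda>s. y(Suc n := s)"
  have fin: "finite ?T" by (rule finite_step) fact
  have meas: "?C n y \<inter> ?A n l \<in> events" for n y l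
    by (intro sets.Int sets_cylinder sets_avoid)
  have "AE \<omega> in chain_law K x. \<omega> \<in> ?C n y \<inter> ?A n (Suc l) \<longrightarrow>
      \<omega> \<in> (\<Union>s\<in>?T - {z}. ?C (Suc n) (?y s) \<inter> ?A (Suc n) l)"
    using AE_cylinder_step[of K y n x, OF fin]
    by eventually_elim (auto simp: cylinder_Suc simp del: fun_upd_apply)
  then have "prob (?C n y \<inter> ?A n (Suc l)) \<le>
      prob (\<Union>s\<in>?T - {z}. ?C (Suc n) (?y s) \<inter> ?A (Suc n) l)"
    using fin meas by (intro finite_measure_mono_AE sets.finite_UN) auto
  also have "\<dots> \<le> (\<Sum>s\<in>?T - {z}. prob (?C (Suc n) (?y s) \<inter> ?A (Suc n) l))"
    using fin meas by (intro finite_measure_subadditive_finite) auto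
  also have "\<dots> \<le> (\<Sum>s\<in>?T - {z}. prob (?C (Suc n) (?y s)) * avoid_prob K z l s)"
  proof (rule sum_mono)
    fix s assume "s \<in> ?T - {z}"
    then have "?y s (Suc n) \<in> S" using closed[of "y n"] Suc.prems by auto
    from Suc.IH[where y="?y s" and n="Suc n", OF this]
    show "prob (?C (Suc n) (?y s) \<inter> ?A (Suc n) l) \<le>
        prob (?C (Suc n) (?y s)) * avoid_prob K z l s"
      by simp
  qed
  also have "\<dots> = prob (?C n y) * (\<Sum>s\<in>?T - {z}. pmf (K (y n)) s * avoid_prob K z l s)"
    unfolding measure_cylinder_Suc by (simp add: sum_distrib_left mult.assoc)
  also have "(\<Sum>s\<in>?T - {z}. pmf (K (y n)) s * avoid_prob K z l s) =
      (\<Sum>s\<in>?T. pmf (K (y n)) s * (if s = z then 0 else avoid_prob K z l s))"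
    using fin by (intro sum.mono_neutral_cong_left) auto
  also have "\<dots> = avoid_prob K z (Suc l) (y n)"
    using expectation_step[OF Suc.prems] by simp
  finally show ?case .
qed

text \<open>At time \<open>N\<close> the Markov bound applies with every \<open>l\<close>, so
  \<open>lim\<close> gives probability 0. Shorter cylinders follow by downward induction, as
  finitely many prolongations cover each of them almost surely.\<close>

lemma AE_avoid_after:
  assumes "x \<in> S" and lim: "\<And>y. y \<in> S \<Longrightarrow> (\<lambda>l. avoid_prob K z l y) \<longlonglongrightarrow> 0"
  shows "AE \<omega> in chain_law K x. \<not> (\<forall>i>N. \<omega> i \<noteq> z)"
proof -
  interpret prob_space "chain_law K x" by (rule prob_space_chain_law)
  let ?C = "\<lambda>n y. {\<omega>. \<forall>i\<le>n. \<omega> i = y i}"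
  let ?B = "{\<omega>. \<forall>i>N. \<omega> i \<noteq> z}"
  have B: "?B \<in> events" by (rule sets_avoid)
  have "AE \<omega> in chain_law K x. \<omega> \<in> ?C n y \<longrightarrow> \<omega> \<notin> ?B" if "y n \<in> S" "n \<le> N" for n y
    using that(2,1)
  proof (induction n arbitrary: y rule: inc_induct)
    case base
    have "prob (?C N y \<inter> ?B) \<le> prob (?C N y) * avoid_prob K z l (y N)" for l
    proof -
      have "prob (?C N y \<inter> ?B) \<le> prob (?C N y \<inter> {\<omega>. \<forall>i. N < i \<and> i \<le> N + l \<longrightarrow> \<omega> i \<noteq> z})"
        by (intro finite_measure_mono sets.Int sets_cylinder sets_avoid) auto
      also note measure_cylinder_avoid[where x=x and z=z and y=y and n=N, OF base]
      finally show ?thesis .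
    qed
    moreover have "(\<lambda>l. prob (?C N y) * avoid_prob K z l (y N)) \<longlonglongrightarrow> prob (?C N y) * 0"
      by (intro tendsto_mult tendsto_const lim base)
    ultimately have "prob (?C N y \<inter> ?B) \<le> prob (?C N y) * 0"
      by (intro LIMSEQ_le_const) auto
    then have "prob (?C N y \<inter> ?B) = 0"
      using measure_nonneg[of "chain_law K x" "?C N y \<inter> ?B"] by linarith
    then have "AE \<omega> in chain_law K x. \<omega> \<notin> ?C N y \<inter> ?B"
      using sets_cylinder[of N y K x] B prob_eq_0 by blast
    then show ?case by eventually_elim auto
  next
    case (step n)
    have fin: "finite (set_pmf (K (y n)))" by (rule finite_step) fact
    have "AE \<omega> in chain_law K x. \<forall>s\<in>set_pmf (K (y n)). \<omega> \<in> ?C (Suc n) (y(Suc n := s)) \<longrightarrow> \<omega> \<notin> ?B"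
      using fin closed[of "y n"] step.prems
      by (intro AE_finite_allI step.IH) auto
    with AE_cylinder_step[of K y n x, OF fin] show ?case
      by eventually_elim (auto simp: cylinder_Suc simp del: fun_upd_apply)
  qed
  from this[of "\<lambda>_. x" 0] have "AE \<omega> in chain_law K x. \<omega> \<in> ?C 0 (\<lambda>_. x) \<longrightarrow> \<omega> \<notin> ?B"
    using assms by simp
  moreover have "prob (?C 0 (\<lambda>_. x)) = 1"
    unfolding chain_law_cylinder by simp
  then have "AE \<omega> in chain_law K x. \<omega> \<in> ?C 0 (\<lambda>_. x)"
    by (rule prob_eq_1[OF sets_cylinder, THEN iffD1])
  ultimately show ?thesis by eventually_elim auto
qed

lemma recurrent_onI:
  assumes "\<And>z y. z \<in> S \<Longrightarrow> y \<in> S \<Longrightarrow> (\<lambda>l. avoid_prob K z l y) \<longlonglongrightarrow> 0"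
  shows "recurrent_on S K"
  unfolding recurrent_on_def
proof
  fix x assume x: "x \<in> S"
  have "AE \<omega> in chain_law K x. \<forall>N. \<not> (\<forall>i>N. \<omega> i \<noteq> x)"
    unfolding AE_all_countable using AE_avoid_after x assms by blast
  then show "AE \<omega> in chain_law K x. \<exists>\<^sub>\<infinity>n. \<omega> n = x"
    by eventually_elim (auto simp: INFM_nat)
qed

text \<open>At a maximum outside \<open>B\<close> the mean over the successors is at least the
  maximum, so every successor attains it too. The maximum thus propagates along a path from
  \<open>p\<close> until the path meets \<open>B\<close>.\<close>

lemma maximum_principle:
  fixes u :: "'s \<Rightarrow> real"
  assumes p: "p \<in> S" "\<And>x. x \<in> S \<Longrightarrow> u x \<le> u p"
    and sub: "\<And>x. x \<in> S - B \<Longrightarrow> u x \<le> measure_pmf.expectation (K x) u"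
    and reach: "(p, b) \<in> {(x, y). y \<in> set_pmf (K x)}\<^sup>*" "b \<in> B"
  shows "\<exists>b\<in>B \<inter> S. u b = u p"
  using reach p
proof (induction rule: converse_rtrancl_induct)
  case base
  then show ?case by auto
next
  case (step x y)
  show ?case
  proof (cases "x \<in> B")
    case False
    have y: "y \<in> set_pmf (K x)" "y \<in> S" using step closed[of x] by auto
    have "u y = u x"
    proof (rule ccontr)
      assume "u y \<noteq> u x"
      with step y have less: "u y < u x" by force
      have "measure_pmf.expectation (K x) u < (\<Sum>v\<in>set_pmf (K x). pmf (K x) v * u x)"
        unfolding expectation_step[OF \<open>x \<in> S\<close>]
      proof (rule sum_strict_mono_ex1)
        show "\<forall>v\<in>set_pmf (K x). pmf (K x) v * u v \<le> pmf (K x) v * u x"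
          using step.prems closed[of x] by (auto intro!: mult_left_mono)
        show "\<exists>v\<in>set_pmf (K x). pmf (K x) v * u v < pmf (K x) v * u x"
          using y less by (intro bexI[of _ y]) (auto simp: pmf_positive)
      qed (rule finite_step[OF \<open>x \<in> S\<close>])
      also have "\<dots> = u x"
        using sum_pmf_eq_1[of "set_pmf (K x)" "K x"] finite_step[OF \<open>x \<in> S\<close>]
        by (simp flip: sum_distrib_right)
      finally show False using sub[of x] step False by simp
    qed
    then show ?thesis using step y by auto
  qed (use step in auto)
qed

text \<open>\<open>sublevel\<close> says that \<open>f\<close> tends to infinity on
  \<open>S\<close>; this supplies the maxima that the bounded function \<open>w\<close> alone might
  not attain.\<close>

lemma nonneg_subharmonic_eq_0:
  fixes w f :: "'s \<Rightarrow> real"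
  assumes irreducible: "\<And>x y. x \<in> S \<Longrightarrow> y \<in> S \<Longrightarrow> (x, y) \<in> {(x, y). y \<in> set_pmf (K x)}\<^sup>*"
    and F: "finite F"
    and super: "\<And>x. x \<in> S - F \<Longrightarrow> measure_pmf.expectation (K x) f \<le> f x"
    and sublevel: "\<And>c. finite {x\<in>S. f x \<le> c}"
    and z: "z \<in> S" "w z = 0"
    and sub: "\<And>x. x \<in> S - {z} \<Longrightarrow> w x \<le> measure_pmf.expectation (K x) w"
    and bounds: "\<And>x. x \<in> S \<Longrightarrow> 0 \<le> w x \<and> w x \<le> 1"
    and x: "x \<in> S"
  shows "w x = 0"
proof -
  \<comment> \<open>With \<open>z\<close> in \<open>B\<close>, both \<open>sub\<close> and
    \<open>super\<close> are available on \<open>S - B\<close>.\<close>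
  define B where "B = insert z (F \<inter> S)"
  have B: "finite B" "B \<subseteq> S" "z \<in> B" using F z by (auto simp: B_def)
  have attain: "\<exists>b\<in>B. w y - e * f y \<le> w b - e * f b" if y: "y \<in> S" and e: "e > 0" for y e
  proof -
    define u where "u = (\<lambda>x. w x - e * f x)"
    define T where "T = {x\<in>S. u y \<le> u x}"
    \<comment> \<open>As \<open>w \<le> 1\<close>, \<open>u y \<le> u x\<close> forces
      \<open>e * f x \<le> 1 - u y\<close>. A maximum over the finite set \<open>T\<close> is one
      over \<open>S\<close>.\<close>
    have "T \<subseteq> {x\<in>S. f x \<le> (1 - u y) / e}"
      using bounds e by (fastforce simp: T_def u_def field_simps)
    then have "finite T" using sublevel finite_subset by blast
    moreover have "y \<in> T" using y by (simp add: T_def)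
    ultimately obtain p where p: "p \<in> T" "\<And>x. x \<in> T \<Longrightarrow> u x \<le> u p"
      using Max_in[of "u ` T"] Max_ge[of "u ` T"] by fastforce
    have "\<exists>b\<in>B \<inter> S. u b = u p"
    proof (rule maximum_principle)
      show "p \<in> S" using p by (simp add: T_def)
      show "u x \<le> u p" if "x \<in> S" for x
        using p that by (cases "x \<in> T") (auto simp: T_def)
      show "u x \<le> measure_pmf.expectation (K x) u" if "x \<in> S - B" for x
      proof -
        have "x \<in> S - F" "x \<in> S - {z}" using that by (auto simp: B_def)
        then have "w x - e * f x \<le>
            measure_pmf.expectation (K x) w - e * measure_pmf.expectation (K x) f"
          using sub super e by (intro diff_mono mult_left_mono) auto
        also have "\<dots> = measure_pmf.expectation (K x) u"
          using that by (simp add: u_def integrable_step)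
        finally show ?thesis by (simp add: u_def)
      qed
      show "(p, z) \<in> {(x, y). y \<in> set_pmf (K x)}\<^sup>*"
        using irreducible z p by (simp add: T_def)
    qed (rule B)
    then obtain b where "b \<in> B" "u b = u p" by blast
    moreover have "u y \<le> u p" using p by (simp add: T_def)
    ultimately show ?thesis by (auto simp: u_def intro!: bexI[of _ b])
  qed
  obtain p where p: "p \<in> B" "\<And>b. b \<in> B \<Longrightarrow> w b \<le> w p"
    using B Max_in[of "w ` B"] Max_ge[of "w ` B"] by fastforce
  have max: "w y \<le> w p" if y: "y \<in> S" for y
  proof (rule field_le_epsilon)
    fix \<delta> :: real assume \<delta>: "\<delta> > 0"
    \<comment> \<open>\<open>D\<close> dominates \<open>f y - f b\<close> for all \<open>b\<close>
      in \<open>B\<close> at once, and the 1 keeps it positive, so the coefficient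
      \<open>\<delta> / D\<close> costs at most \<open>\<delta>\<close>.\<close>
    define D where "D = 1 + (\<Sum>b\<in>B. \<bar>f y - f b\<bar>)"
    have D: "D > 0" by (simp add: D_def sum_nonneg add_pos_nonneg)
    obtain b where b: "b \<in> B" "w y - \<delta> / D * f y \<le> w b - \<delta> / D * f b"
      using attain[OF y, of "\<delta> / D"] \<delta> D by auto
    have "f y - f b \<le> \<bar>f y - f b\<bar>" by simp
    also have "\<dots> \<le> D"
      using member_le_sum[of b B "\<lambda>b. \<bar>f y - f b\<bar>"] B b by (simp add: D_def)
    finally have "\<delta> / D * (f y - f b) \<le> \<delta> / D * D"
      using \<delta> D by (intro mult_left_mono) auto
    then show "w y \<le> w p + \<delta>"
      using b p(2)[of b] D by (simp add: right_diff_distrib)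
  qed
  \<comment> \<open>The principle is used a second time, for \<open>w\<close> itself with
    exceptional set \<open>{z}\<close>.\<close>
  have "\<exists>b\<in>{z} \<inter> S. w b = w p"
    using B p by (intro maximum_principle[where b=z] max sub irreducible z) auto
  then show ?thesis using max[OF x] bounds[OF x] z by auto
qed

lemma recurrent_on_Lyapunov:
  fixes f :: "'s \<Rightarrow> real"
  assumes irreducible: "\<And>x y. x \<in> S \<Longrightarrow> y \<in> S \<Longrightarrow> (x, y) \<in> {(x, y). y \<in> set_pmf (K x)}\<^sup>*"
    and F: "finite F"
    and super: "\<And>x. x \<in> S - F \<Longrightarrow> measure_pmf.expectation (K x) f \<le> f x"
    and sublevel: "\<And>c. finite {x\<in>S. f x \<le> c}"
  shows "recurrent_on S K"
proof (rule recurrent_onI)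
  fix z y assume z: "z \<in> S" and y: "y \<in> S"
  \<comment> \<open>\<open>v\<close> ignores a visit at time 0 and \<open>w\<close> counts it:
    \<open>v\<close> is the mean of \<open>w\<close> at every point of \<open>S\<close>, whereas
    \<open>w\<close> vanishes at \<open>z\<close>. Hence \<open>w = 0\<close> is carried over to
    \<open>v\<close> at the end.\<close>
  define v where "v = (\<lambda>x. lim (\<lambda>n. avoid_prob K z n x))"
  define w where "w = (\<lambda>x. if x = z then 0 else v x)"
  have v_lim: "(\<lambda>n. avoid_prob K z n x) \<longlonglongrightarrow> v x" if x: "x \<in> S" for x
  proof -
    have "decseq (\<lambda>n. avoid_prob K z n x)"
      using avoid_prob_decreasing[OF x] by (intro decseq_SucI)
    moreover have "0 \<le> avoid_prob K z n x" for n
      using avoid_prob_bounds[OF x] by simp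
    ultimately have "convergent (\<lambda>n. avoid_prob K z n x)"
      by (metis decseq_convergent convergentI)
    then show ?thesis by (simp add: v_def convergent_LIMSEQ_iff)
  qed
  have v_bounds: "0 \<le> v x \<and> v x \<le> 1" if x: "x \<in> S" for x
    using LIMSEQ_le_const[OF v_lim[OF x]] LIMSEQ_le_const2[OF v_lim[OF x]] avoid_prob_bounds[OF x]
    by blast
  have v_eq: "v x = measure_pmf.expectation (K x) w" if x: "x \<in> S" for x
  proof -
    have "(\<lambda>n. \<Sum>y\<in>set_pmf (K x). pmf (K x) y * (if y = z then 0 else avoid_prob K z n y))
        \<longlonglongrightarrow> (\<Sum>y\<in>set_pmf (K x). pmf (K x) y * w y)"
      using v_lim closed[OF x] by (intro tendsto_sum tendsto_mult tendsto_const) (auto simp: w_def)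
    then have "(\<lambda>n. avoid_prob K z (Suc n) x) \<longlonglongrightarrow> measure_pmf.expectation (K x) w"
      using x by (simp add: expectation_step)
    with LIMSEQ_Suc[OF v_lim[OF x]] show ?thesis by (rule LIMSEQ_unique)
  qed
  have w: "w x = 0" if "x \<in> S" for x
  proof (rule nonneg_subharmonic_eq_0[where F=F and f=f and z=z and w=w and x=x])
    show "w x \<le> measure_pmf.expectation (K x) w" if "x \<in> S - {z}" for x
      using that v_eq[of x] by (simp add: w_def)
  qed (use assms z v_bounds that in \<open>auto simp: w_def\<close>)
  have "measure_pmf.expectation (K y) w \<le> measure_pmf.expectation (K y) (\<lambda>_. 0)"
    using w by (intro expectation_step_mono y) auto
  then have "v y = 0" using v_eq[OF y] v_bounds[OF y] by simp
  then show "(\<lambda>l. avoid_prob K z l y) \<longlonglongrightarrow> 0" using v_lim[OF y] by simp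
qed

end

section \<open>The steps of the walk\<close>

lemma set_pmf_walk_kernel:
  assumes "d > 0" "\<gamma> > 0"
  shows "set_pmf (walk_kernel d \<gamma> x) = (\<lambda>(k, s). x(k := x k + s)) ` ({..<d} \<times> {-1, 1})"
proof -
  have "coord_weight d \<gamma> x k \<noteq> 0 \<longleftrightarrow> k < d" for k
    using assms by (auto simp: coord_weight_def)
  then have "set_pmf (embed_pmf (coord_weight d \<gamma> x)) = {..<d}"
    using assms by (auto simp: set_pmf_eq pmf_coord_weight)
  then show ?thesis by (simp add: walk_kernel_def)
qed

lemma expectation_walk_kernel:
  fixes f :: "(nat \<Rightarrow> int) \<Rightarrow> real"
  assumes "d > 0" "\<gamma> > 0"
  shows "measure_pmf.expectation (walk_kernel d \<gamma> x) f =
    (\<Sum>k<d. coord_weight d \<gamma> x k * ((f (x(k := x k + 1)) + f (x(k := x k - 1))) / 2))"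
proof -
  let ?p = "pair_pmf (embed_pmf (coord_weight d \<gamma> x)) (pmf_of_set {-1, 1 :: int})"
  let ?h = "\<lambda>(k, s). x(k := x k + s)"
  have "measure_pmf.expectation (walk_kernel d \<gamma> x) f = measure_pmf.expectation ?p (\<lambda>q. f (?h q))"
    by (simp add: walk_kernel_def)
  also have "\<dots> = (\<Sum>q\<in>{..<d} \<times> {-1, 1}. pmf ?p q * f (?h q))"
  proof (subst integral_measure_pmf)
    fix q assume "q \<in> set_pmf ?p"
    then have "pmf (embed_pmf (coord_weight d \<gamma> x)) (fst q) \<noteq> 0" "snd q \<in> {-1, 1}"
      by (auto simp: set_pmf_iff[symmetric])
    then show "q \<in> {..<d} \<times> {-1, 1}"
      using assms by (cases q) (auto simp: pmf_coord_weight coord_weight_def split: if_splits)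
  qed auto
  also have "\<dots> = (\<Sum>k<d. \<Sum>s\<in>{-1, 1}. pmf ?p (k, s) * f (?h (k, s)))"
    unfolding sum.cartesian_product by (intro sum.cong) auto
  also have "\<dots> = (\<Sum>k<d. coord_weight d \<gamma> x k * ((f (x(k := x k + 1)) + f (x(k := x k - 1))) / 2))"
    using assms by (intro sum.cong) (auto simp: pmf_pair pmf_coord_weight algebra_simps add_divide_distrib)
  finally show ?thesis .
qed

lemma lattice_update: "x \<in> lattice d \<Longrightarrow> k < d \<Longrightarrow> x(k := s) \<in> lattice d"
  by (auto simp: lattice_def)

text \<open>All neighbours have positive probability, so steps can be reversed and it is enough to
  lead every point to the origin, lowering the sum of the absolute values each time.\<close>

lemma walk_irreducible:
  assumes "d > 0" "\<gamma> > 0" "x \<in> lattice d" "y \<in> lattice d"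
  shows "(x, y) \<in> {(x, y). y \<in> set_pmf (walk_kernel d \<gamma> x)}\<^sup>*" (is "_ \<in> ?R\<^sup>*")
proof -
  have step: "(x, x(k := x k + s)) \<in> ?R" if "k < d" "s \<in> {-1, 1}" for x k s
    using that assms(1,2) by (force simp: set_pmf_walk_kernel)
  have "sym ?R"
  proof (rule symI)
    fix x y assume "(x, y) \<in> ?R"
    then obtain k s where ks: "k < d" "s \<in> {-1, 1}" "y = x(k := x k + s)"
      using assms(1,2) by (auto simp: set_pmf_walk_kernel)
    then have "y(k := y k + - s) = x" by auto
    then show "(y, x) \<in> ?R" using step[of k "- s" y] ks by auto
  qed
  then have sym: "sym (?R\<^sup>*)" by (rule sym_rtrancl)
  have to_0: "(x, \<lambda>_. 0) \<in> ?R\<^sup>*" if "x \<in> lattice d" for x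
    using that
  proof (induction "\<Sum>k<d. nat \<bar>x k\<bar>" arbitrary: x rule: less_induct)
    case less
    show ?case
    proof (cases "\<exists>k<d. x k \<noteq> 0")
      case True
      then obtain k where k: "k < d" "x k \<noteq> 0" by blast
      define y where "y = x(k := x k - sgn (x k))"
      have "(\<Sum>j<d. nat \<bar>y j\<bar>) < (\<Sum>j<d. nat \<bar>x j\<bar>)"
        by (rule sum_strict_mono_ex1)
           (use k in \<open>auto simp: y_def sgn_if intro!: bexI[of _ k]\<close>)
      then have "(y, \<lambda>_. 0) \<in> ?R\<^sup>*"
        using less k by (intro less.hyps) (auto simp: y_def intro: lattice_update)
      moreover have "(x, y) \<in> ?R"
        using step[of k "- sgn (x k)" x] k by (auto simp: y_def sgn_if)
      ultimately show ?thesis by (rule converse_rtrancl_into_rtrancl[rotated])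
    next
      case False
      with less.prems have "x = (\<lambda>_. 0)" by (auto simp: lattice_def fun_eq_iff not_le[symmetric])
      then show ?thesis by simp
    qed
  qed
  show ?thesis
    using to_0[OF assms(3)] symD[OF sym to_0[OF assms(4)]] by (rule rtrancl_trans)
qed

lemma finite_lattice_box: "finite {x \<in> lattice d. \<forall>k<d. \<bar>x k\<bar> \<le> c}"
proof (rule finite_subset)
  show "{x \<in> lattice d. \<forall>k<d. \<bar>x k\<bar> \<le> c} \<subseteq>
      {x. \<forall>k. (k \<in> {..<d} \<longrightarrow> x k \<in> {-c..c}) \<and> (k \<notin> {..<d} \<longrightarrow> x k = 0)}"
    by (auto simp: lattice_def)
qed (intro finite_set_of_finite_funs; simp)

lemma abs_le_max_index: "j < d \<Longrightarrow> \<bar>x j\<bar> \<le> \<bar>x (max_index d x)\<bar>"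
  using max_index(2)[of d x] by (auto intro!: Max_ge)

section \<open>The Lyapunov function\<close>

text \<open>The term \<open>(e * x m)\<^sup>2\<close> rounds off the kink of
  \<open>\<bar>x k\<bar>\<close> at 0 on a scale proportional to \<open>\<bar>x m\<bar>\<close>,
  which keeps the function homogeneous of degree one.\<close>

definition sector_norm :: "nat \<Rightarrow> real \<Rightarrow> nat \<Rightarrow> (nat \<Rightarrow> int) \<Rightarrow> real" where
  "sector_norm d e m x =
     \<bar>x m\<bar> / 2 + (\<Sum>k\<in>{..<d} - {m}. sqrt ((real_of_int (x k))\<^sup>2 + (e * x m)\<^sup>2))"

section \<open>Size and comparison of the sector norms\<close>

lemma sector_norm_ge: "sector_norm d e m x \<ge> \<bar>x m\<bar> / 2"
  by (simp add: sector_norm_def sum_nonneg)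

text \<open>Second differences of the sector norm will be at most of order
  \<open>1 / \<bar>x m\<bar>\<close>; this linear bound keeps their product with the norm
  bounded.\<close>

lemma sector_norm_le:
  assumes "0 \<le> e" "e \<le> 1" "m < d" and max: "\<And>j. j < d \<Longrightarrow> \<bar>x j\<bar> \<le> \<bar>x m\<bar>"
  shows "sector_norm d e m x \<le> 2 * real d * \<bar>x m\<bar>"
proof -
  let ?M = "real_of_int \<bar>x m\<bar>"
  have "sqrt ((real_of_int (x k))\<^sup>2 + (e * x m)\<^sup>2) \<le> 2 * ?M" if "k < d" for k
  proof -
    have "sqrt ((real_of_int (x k))\<^sup>2 + (e * x m)\<^sup>2) \<le> \<bar>real_of_int (x k)\<bar> + \<bar>e * x m\<bar>"
      by (rule sqrt_sum_squares_le_sum_abs)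
    also have "\<bar>e * x m\<bar> \<le> ?M"
      using assms by (simp add: abs_mult mult_left_le_one_le)
    also have "\<bar>real_of_int (x k)\<bar> \<le> ?M" using max[OF that] by linarith
    finally show ?thesis by simp
  qed
  then have "sector_norm d e m x \<le> ?M / 2 + (\<Sum>k\<in>{..<d} - {m}. 2 * ?M)"
    unfolding sector_norm_def by (intro add_mono sum_mono) auto
  also have "\<dots> \<le> 2 * real d * ?M"
    using assms by (simp add: of_nat_diff algebra_simps)
  finally show ?thesis .
qed

text \<open>Multiplied by the sum of the roots, their difference becomes
  \<open>(1 - e\<^sup>2) * (a\<^sup>2 - b\<^sup>2)\<close>, and that sum is at most
  \<open>(1 + e) * (a + b)\<close>.\<close>

lemma sqrt_diff_ge:
  fixes a b e :: real
  assumes "0 \<le> b" "b \<le> a" "0 \<le> e" "e \<le> 1"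
  shows "sqrt (a\<^sup>2 + (e * b)\<^sup>2) - sqrt (b\<^sup>2 + (e * a)\<^sup>2) \<ge> (1 - e) * (a - b)"
proof (cases "a > 0")
  case True
  let ?p = "sqrt (a\<^sup>2 + (e * b)\<^sup>2)" and ?q = "sqrt (b\<^sup>2 + (e * a)\<^sup>2)"
  have p: "?p \<le> a + e * b" and q: "?q \<le> b + e * a"
    using sqrt_sum_squares_le_sum_abs[of a "e * b"] sqrt_sum_squares_le_sum_abs[of b "e * a"] assms
    by (auto simp: abs_mult)
  have pos: "?p + ?q > 0"
    using True by (intro add_pos_nonneg) (auto simp: sum_power2_gt_zero_iff)
  have "(1 - e) * (a - b) * (?p + ?q) \<le> (1 - e) * (a - b) * ((1 + e) * (a + b))"
    using p q assms by (intro mult_left_mono mult_nonneg_nonneg) (auto simp: algebra_simps)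
  also have "\<dots> = (a\<^sup>2 + (e * b)\<^sup>2) - (b\<^sup>2 + (e * a)\<^sup>2)"
    by (simp add: power2_eq_square algebra_simps)
  also have "\<dots> = ?p\<^sup>2 - ?q\<^sup>2" by simp
  also have "\<dots> = (?p - ?q) * (?p + ?q)"
    by (simp only: power2_eq_square algebra_simps)
  finally show ?thesis using pos by (simp add: mult_le_cancel_right)
next
  case False
  with assms have "a = 0" "b = 0" by auto
  then show ?thesis by simp
qed

text \<open>The triangle inequality in the plane: as a function of \<open>a\<close> the root is
  Lipschitz with constant \<open>e\<close>.\<close>

lemma sqrt_mono_diff:
  fixes y a b e :: real
  assumes "0 \<le> b" "b \<le> a" "0 \<le> e"
  shows "sqrt (y\<^sup>2 + (e * a)\<^sup>2) - sqrt (y\<^sup>2 + (e * b)\<^sup>2) \<le> e * (a - b)"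
proof -
  have "sqrt (y\<^sup>2 + (e * b + e * (a - b))\<^sup>2) \<le> sqrt (y\<^sup>2 + (e * b)\<^sup>2) + sqrt (0\<^sup>2 + (e * (a - b))\<^sup>2)"
    using real_sqrt_sum_squares_triangle_ineq[of y 0 "e * b" "e * (a - b)"] by simp
  moreover have "e * b + e * (a - b) = e * a" by (simp add: algebra_simps)
  moreover have "sqrt (0\<^sup>2 + (e * (a - b))\<^sup>2) = e * (a - b)" using assms by simp
  ultimately show ?thesis by simp
qed

text \<open>Let \<open>a = \<bar>x m\<bar>\<close> and \<open>b = \<bar>x k\<bar>\<close>. Passing
  from \<open>m\<close> to \<open>k\<close> loses \<open>(a - b) / 2\<close> in the linear term and
  at most \<open>e * (a - b)\<close> in each of the \<open>d - 2\<close> other roots, but exchanging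
  the two coordinates gains at least \<open>(1 - e) * (a - b)\<close>.\<close>

lemma sector_norm_le_sector_norm:
  assumes e: "0 < e" "2 * real d * e \<le> 1" and mk: "m < d" "k < d" "\<bar>x k\<bar> \<le> \<bar>x m\<bar>"
  shows "sector_norm d e m x \<le> sector_norm d e k x"
proof (cases "m = k")
  case False
  define a b where "a = real_of_int \<bar>x m\<bar>" and "b = real_of_int \<bar>x k\<bar>"
  have ab: "0 \<le> b" "b \<le> a" using mk(3) by (simp_all add: a_def b_def del: of_int_abs)
  have "1 * e \<le> real d * e" using mk e by (intro mult_right_mono) auto
  with e have e1: "e \<le> 1" by linarith
  let ?J = "{..<d} - {m} - {k}"
  let ?s = "\<lambda>y c. sqrt ((real_of_int y)\<^sup>2 + (e * c)\<^sup>2)"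
  have sq: "(e * real_of_int (x m))\<^sup>2 = (e * a)\<^sup>2" "(e * real_of_int (x k))\<^sup>2 = (e * b)\<^sup>2"
    "(real_of_int (x m))\<^sup>2 = a\<^sup>2" "(real_of_int (x k))\<^sup>2 = b\<^sup>2"
    by (simp_all add: a_def b_def power_mult_distrib)
  have gm: "sector_norm d e m x = a / 2 + sqrt (b\<^sup>2 + (e * a)\<^sup>2) + (\<Sum>j\<in>?J. ?s (x j) a)"
    unfolding sector_norm_def sq using mk False
    by (subst sum.remove[of _ k]) (auto simp: a_def sq)
  have gk: "sector_norm d e k x = b / 2 + sqrt (a\<^sup>2 + (e * b)\<^sup>2) + (\<Sum>j\<in>?J. ?s (x j) b)"
    unfolding sector_norm_def sq using mk False
    by (subst sum.remove[of _ m]) (auto simp: b_def sq Diff_insert2[symmetric] insert_commute)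
  have "(\<Sum>j\<in>?J. ?s (x j) a) - (\<Sum>j\<in>?J. ?s (x j) b) \<le> (\<Sum>j\<in>?J. e * (a - b))"
    unfolding sum_subtractf[symmetric] using ab e by (intro sum_mono sqrt_mono_diff) auto
  also have "\<dots> = (real d - 2) * e * (a - b)"
    using mk False by (simp add: of_nat_diff card_Diff_singleton_if)
  finally have J: "(\<Sum>j\<in>?J. ?s (x j) a) - (\<Sum>j\<in>?J. ?s (x j) b) \<le> (real d - 2) * e * (a - b)" .
  \<comment> \<open>The gain outweighs the losses because
    \<open>2 * real d * e \<le> 1\<close>.\<close>
  have "(1 / 2 + (real d - 2) * e) * (a - b) \<le> (1 - e) * (a - b)"
    using ab e by (intro mult_right_mono) (auto simp: algebra_simps)
  also have "\<dots> \<le> sqrt (a\<^sup>2 + (e * b)\<^sup>2) - sqrt (b\<^sup>2 + (e * a)\<^sup>2)"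
    using ab e e1 by (intro sqrt_diff_ge) auto
  finally have "a / 2 - b / 2 + (real d - 2) * e * (a - b) \<le> sqrt (a\<^sup>2 + (e * b)\<^sup>2) - sqrt (b\<^sup>2 + (e * a)\<^sup>2)"
    by (simp add: algebra_simps diff_divide_distrib)
  then show ?thesis using J unfolding gm gk by linarith
qed simp

section \<open>Second differences of the sector norms\<close>

lemma sqrt_second_difference:
  fixes y t b :: real
  assumes "0 \<le> b" "0 < y\<^sup>2 + b"
  shows "sqrt ((y + t)\<^sup>2 + b) + sqrt ((y - t)\<^sup>2 + b) \<le> 2 * sqrt (y\<^sup>2 + b) + t\<^sup>2 / sqrt (y\<^sup>2 + b)"
proof -
  define q where "q = sqrt (y\<^sup>2 + b)"
  have q: "q > 0" "q\<^sup>2 = y\<^sup>2 + b" using assms by (auto simp: q_def)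
  \<comment> \<open>The tangent to the square root at \<open>q\<^sup>2\<close>; when the bounds for
    \<open>t\<close> and \<open>- t\<close> are added, the terms linear in \<open>t\<close>
    cancel.\<close>
  have amgm: "sqrt u \<le> (q\<^sup>2 + u) / (2 * q)" if "u \<ge> 0" for u
  proof -
    have "0 \<le> (q - sqrt u)\<^sup>2" by simp
    then have "2 * q * sqrt u \<le> q\<^sup>2 + u" using that by (simp add: power2_diff)
    then show ?thesis using q by (simp add: field_simps)
  qed
  have "sqrt ((y + t)\<^sup>2 + b) + sqrt ((y - t)\<^sup>2 + b) \<le>
      (q\<^sup>2 + ((y + t)\<^sup>2 + b)) / (2 * q) + (q\<^sup>2 + ((y - t)\<^sup>2 + b)) / (2 * q)"
    using assms by (intro add_mono amgm) auto
  also have "\<dots> = (4 * q\<^sup>2 + 2 * t\<^sup>2) / (2 * q)"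
    unfolding q(2) by (simp add: add_divide_distrib[symmetric] power2_eq_square algebra_simps)
  also have "\<dots> = 2 * q + t\<^sup>2 / q"
    using q(1) by (simp add: field_simps power2_eq_square)
  finally show ?thesis by (simp add: q_def)
qed

text \<open>Since \<open>4 * p * q = (p + q)\<^sup>2 - (p - q)\<^sup>2\<close>, an upper bound on
  the sum and a lower bound on the gap bound the product.\<close>

lemma mult_le_of_add_le:
  fixes p q :: real
  assumes "p + q \<le> 2 * s" "0 \<le> p + q" "r \<le> \<bar>p - q\<bar>" "0 \<le> r"
  shows "p * q \<le> s\<^sup>2 - (r / 2)\<^sup>2"
proof -
  have "(p + q)\<^sup>2 \<le> (2 * s)\<^sup>2" using assms by (intro power_mono)
  moreover have "r\<^sup>2 \<le> \<bar>p - q\<bar>\<^sup>2" using assms by (intro power_mono)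
  ultimately show ?thesis by (simp add: power2_eq_square algebra_simps)
qed

text \<open>The varying root is at least \<open>e * \<bar>x m\<bar>\<close>, so the second
  difference is at most \<open>1 / (e * \<bar>x m\<bar>)\<close>. Its product with the norm gives
  \<open>2 * real d / e\<close>, the square of half of it the other constant.\<close>

lemma sector_norm_other_step:
  assumes e: "0 < e" "e \<le> 1" and m: "m < d" "x m \<noteq> 0" "\<And>j. j < d \<Longrightarrow> \<bar>x j\<bar> \<le> \<bar>x m\<bar>"
    and k: "k < d" "k \<noteq> m"
  shows "sector_norm d e m (x(k := x k + 1)) * sector_norm d e m (x(k := x k - 1))
    \<le> (sector_norm d e m x)\<^sup>2 + (2 * real d / e + 1 / (4 * e\<^sup>2))"
proof -
  define M where "M = real_of_int \<bar>x m\<bar>"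
  have M: "M \<ge> 1" using m(2) by (simp add: M_def)
  let ?s = "\<lambda>y. sqrt (y\<^sup>2 + (e * real_of_int (x m))\<^sup>2)"
  define R where "R = \<bar>x m\<bar> / 2 + (\<Sum>j\<in>{..<d} - {m} - {k}. ?s (x j))"
  have g: "sector_norm d e m (x(k := s)) = R + ?s s" for s
  proof -
    have "(\<Sum>j\<in>{..<d} - {m}. ?s ((x(k := s)) j)) = ?s s + (\<Sum>j\<in>{..<d} - {m} - {k}. ?s ((x(k := s)) j))"
      using k by (subst sum.remove[of _ k]) auto
    also have "(\<Sum>j\<in>{..<d} - {m} - {k}. ?s ((x(k := s)) j)) = (\<Sum>j\<in>{..<d} - {m} - {k}. ?s (x j))"
      by (intro sum.cong) auto
    finally show ?thesis using k by (simp add: sector_norm_def R_def)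
  qed
  define G where "G = sector_norm d e m x"
  have G: "G = R + ?s (x k)" using g[of "x k"] by (simp add: G_def)
  have G_le: "G \<le> 2 * real d * M"
    unfolding G_def M_def using e m by (intro sector_norm_le) auto
  have pos: "0 < (real_of_int (x k))\<^sup>2 + (e * real_of_int (x m))\<^sup>2"
    using m e by (simp add: sum_power2_gt_zero_iff)
  have "e * M = sqrt ((e * real_of_int (x m))\<^sup>2)" using e by (simp add: M_def abs_mult)
  also have "\<dots> \<le> ?s (x k)" by simp
  finally have "1 / ?s (x k) \<le> 1 / (e * M)"
    using e M real_sqrt_gt_zero[OF pos] by (intro divide_left_mono mult_pos_pos) auto
  with sqrt_second_difference[OF _ pos, of 1]
  have "?s (x k + 1) + ?s (x k - 1) \<le> 2 * ?s (x k) + 1 / (e * M)" by simp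
  then have "sector_norm d e m (x(k := x k + 1)) + sector_norm d e m (x(k := x k - 1)) \<le> 2 * (G + 1 / (2 * e * M))"
    unfolding g G by simp
  \<comment> \<open>The gap between the factors vanishes at \<open>x k = 0\<close>, so it is bounded
    below by 0 only.\<close>
  then have "sector_norm d e m (x(k := x k + 1)) * sector_norm d e m (x(k := x k - 1)) \<le>
      (G + 1 / (2 * e * M))\<^sup>2 - (0 / 2)\<^sup>2"
    using sector_norm_ge[of "x(k := x k + 1)" m d e] sector_norm_ge[of "x(k := x k - 1)" m d e] M
    by (intro mult_le_of_add_le) (auto simp: M_def)
  also have "\<dots> = G\<^sup>2 + G / (e * M) + 1 / (4 * e\<^sup>2 * M\<^sup>2)"
    using e M by (simp add: power2_eq_square field_simps)
  also have "G / (e * M) \<le> 2 * real d * M / (e * M)"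
    using G_le e M by (intro divide_right_mono) auto
  also have "\<dots> = 2 * real d / e" using M by simp
  also have "1 / (4 * e\<^sup>2 * M\<^sup>2) \<le> 1 / (4 * e\<^sup>2)"
    using e M by (intro divide_left_mono) (auto simp: mult_le_cancel_left1)
  finally show ?thesis by (simp add: G_def add.assoc del: fun_upd_apply)
qed

text \<open>The linear term alone makes the gap at least 1, which lowers the product by 1/4. The
  curvature of the roots gives back at most 1/16 twice: through
  \<open>2 * (real d)\<^sup>2 * e\<close> and through a square.\<close>

lemma sector_norm_max_step:
  assumes e: "0 < e" "32 * (real d)\<^sup>2 * e \<le> 1"
    and m: "m < d" "x m \<noteq> 0" "\<And>j. j < d \<Longrightarrow> \<bar>x j\<bar> \<le> \<bar>x m\<bar>"
  shows "sector_norm d e m (x(m := x m + 1)) * sector_norm d e m (x(m := x m - 1)) \<le> (sector_norm d e m x)\<^sup>2 - 1 / 8"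
proof -
  define M where "M = real_of_int \<bar>x m\<bar>"
  have M: "M \<ge> 1" using m(2) by (simp add: M_def)
  have d: "real d \<ge> 1" using m(1) by simp
  have "e * 1 \<le> e * (32 * (real d)\<^sup>2)"
    using e(1) one_le_power[OF d, of 2] by (intro mult_left_mono) linarith+
  with e have e1: "e \<le> 1" by (simp only: mult_1_right mult.commute[of e])
  let ?s = "\<lambda>y c. sqrt (y\<^sup>2 + (e * c)\<^sup>2)"
  define h where "h c = c / 2 + (\<Sum>k\<in>{..<d} - {m}. ?s (x k) c)" for c :: real
  have g: "sector_norm d e m (x(m := s)) = h \<bar>s\<bar>" for s
    unfolding sector_norm_def h_def by (auto simp: power_mult_distrib intro!: sum.cong)
  have G: "sector_norm d e m x = h M" using g[of "x m"] by (simp add: M_def)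
  \<comment> \<open>The sign of \<open>x m\<close> only swaps the two factors.\<close>
  have "\<bar>x m + 1\<bar> = \<bar>x m\<bar> + 1 \<and> \<bar>x m - 1\<bar> = \<bar>x m\<bar> - 1 \<or>
      \<bar>x m + 1\<bar> = \<bar>x m\<bar> - 1 \<and> \<bar>x m - 1\<bar> = \<bar>x m\<bar> + 1"
    using m(2) by auto
  then have prod: "sector_norm d e m (x(m := x m + 1)) * sector_norm d e m (x(m := x m - 1)) = h (M + 1) * h (M - 1)"
    unfolding g by (auto simp: M_def)
  have G_le: "h M \<le> 2 * real d * M"
    using sector_norm_le[of e m d x] e e1 m by (simp add: G M_def[symmetric] del: of_int_abs)
  have "?s (x k) (M + 1) + ?s (x k) (M - 1) \<le> 2 * ?s (x k) M + e / M" for k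
  proof -
    have "0 < (e * M)\<^sup>2 + (real_of_int (x k))\<^sup>2"
      using e M by (simp add: sum_power2_gt_zero_iff)
    \<comment> \<open>Here \<open>e * M\<close> moves by \<open>e\<close> while \<open>x k\<close>
      stays fixed, so the numerator is \<open>e\<^sup>2\<close> and a factor \<open>e\<close>
      survives in \<open>e / M\<close>.\<close>
    from sqrt_second_difference[OF _ this, of e]
    have "?s (x k) (M + 1) + ?s (x k) (M - 1) \<le> 2 * ?s (x k) M + e\<^sup>2 / ?s (x k) M"
      by (simp add: algebra_simps)
    also have "e * M \<le> ?s (x k) M" using e M by (intro real_le_rsqrt) auto
    then have "e\<^sup>2 / ?s (x k) M \<le> e\<^sup>2 / (e * M)"
      using e M by (intro divide_left_mono) (auto intro!: mult_pos_pos simp: add_nonneg_pos)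
    also have "e\<^sup>2 / (e * M) = e / M" using e by (simp add: power2_eq_square)
    finally show ?thesis by simp
  qed
  then have "(\<Sum>k\<in>{..<d} - {m}. ?s (x k) (M + 1) + ?s (x k) (M - 1)) \<le>
      (\<Sum>k\<in>{..<d} - {m}. 2 * ?s (x k) M + e / M)"
    by (intro sum_mono)
  then have "(\<Sum>k\<in>{..<d} - {m}. ?s (x k) (M + 1)) + (\<Sum>k\<in>{..<d} - {m}. ?s (x k) (M - 1)) \<le>
      2 * (\<Sum>k\<in>{..<d} - {m}. ?s (x k) M) + (real d - 1) * (e / M)"
    using m(1) by (simp add: sum.distrib sum_distrib_left[symmetric] of_nat_diff)
  then have "h (M + 1) + h (M - 1) \<le> 2 * h M + (real d - 1) * (e / M)"
    unfolding h_def by argo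
  also have "\<dots> \<le> 2 * h M + real d * (e / M)"
    using e M by (intro add_left_mono mult_right_mono) auto
  finally have add: "h (M + 1) + h (M - 1) \<le> 2 * (h M + real d * e / (2 * M))" by simp
  have "h (M + 1) - h (M - 1) =
      1 + (\<Sum>k\<in>{..<d} - {m}. ?s (x k) (M + 1) - ?s (x k) (M - 1))"
    by (simp add: h_def sum_subtractf field_simps)
  moreover have "0 \<le> (\<Sum>k\<in>{..<d} - {m}. ?s (x k) (M + 1) - ?s (x k) (M - 1))"
    using e M by (intro sum_nonneg) (auto intro!: power_mono mult_left_mono)
  ultimately have diff: "1 \<le> \<bar>h (M + 1) - h (M - 1)\<bar>" by linarith
  have "0 \<le> h (M + 1) + h (M - 1)"
    using M by (auto simp: h_def intro!: add_nonneg_nonneg sum_nonneg)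
  then have "h (M + 1) * h (M - 1) \<le> (h M + real d * e / (2 * M))\<^sup>2 - (1 / 2)\<^sup>2"
    by (intro mult_le_of_add_le add diff) auto
  also have "\<dots> = (h M)\<^sup>2 + h M * (real d * e / M) + (real d * e / (2 * M))\<^sup>2 - 1 / 4"
    using M by (simp add: power2_eq_square field_simps)
  also have "h M * (real d * e / M) \<le> 2 * real d * M * (real d * e / M)"
    using G_le e M by (intro mult_right_mono) auto
  also have "\<dots> = 2 * (real d)\<^sup>2 * e" using M by (simp add: power2_eq_square)
  also have "\<dots> \<le> 1 / 16" using e by simp
  also have "(real d * e / (2 * M))\<^sup>2 \<le> (1 / 4)\<^sup>2"
  proof (rule power_mono)
    have "real d * 1 * e \<le> real d * real d * e"
      using d e by (intro mult_right_mono mult_left_mono) auto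
    then have "2 * (real d * e) \<le> 1 * 1" using e by (simp add: power2_eq_square)
    also have "1 * 1 \<le> 1 * M" using M by simp
    finally show "real d * e / (2 * M) \<le> 1 / 4" using M by (simp add: field_simps)
  qed (use e M in auto)
  finally show ?thesis unfolding prod G by (simp add: power2_eq_square)
qed

text \<open>The value \<open>ln 0 = 0\<close> at the origin is harmless: the origin and its neighbours lie in the
  finite exceptional set.\<close>

definition lyapunov :: "nat \<Rightarrow> real \<Rightarrow> (nat \<Rightarrow> int) \<Rightarrow> real" where
  "lyapunov d e x = ln (sector_norm d e (max_index d x) x)"

section \<open>Drift and growth of the logarithm\<close>

lemma lyapunov_le:
  assumes "0 < e" "2 * real d * e \<le> 1" "m < d" "\<exists>k<d. x k \<noteq> 0"
  shows "lyapunov d e x \<le> ln (sector_norm d e m x)"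
proof -
  obtain k where "k < d" "x k \<noteq> 0" using assms by blast
  then have "0 < sector_norm d e (max_index d x) x"
    using abs_le_max_index[of k d x] sector_norm_ge[of x "max_index d x" d e] by simp
  moreover have "sector_norm d e (max_index d x) x \<le> sector_norm d e m x"
    using assms by (intro sector_norm_le_sector_norm max_index abs_le_max_index) auto
  ultimately show ?thesis by (simp add: lyapunov_def)
qed

lemma lyapunov_second_difference:
  assumes e: "0 < e" "2 * real d * e \<le> 1" and k: "k < d"
    and m: "m = max_index d x" "\<bar>x m\<bar> \<ge> 2"
    and c: "sector_norm d e m (x(k := x k + 1)) * sector_norm d e m (x(k := x k - 1)) \<le> (sector_norm d e m x)\<^sup>2 + c"
  shows "lyapunov d e (x(k := x k + 1)) + lyapunov d e (x(k := x k - 1))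
    \<le> 2 * lyapunov d e x + c / (sector_norm d e m x)\<^sup>2"
proof -
  have md: "m < d" using max_index(1)[of d x] k m by simp
  define G P Q where "G = sector_norm d e m x" and "P = sector_norm d e m (x(k := x k + 1))"
    and "Q = sector_norm d e m (x(k := x k - 1))"
  \<comment> \<open>\<open>\<bar>x m\<bar> \<ge> 2\<close> keeps coordinate \<open>m\<close> nonzero
    after any step, so the logarithms below have positive arguments.\<close>
  have nz: "(x(k := x k + 1)) m \<noteq> 0" "(x(k := x k - 1)) m \<noteq> 0" using m(2) by auto
  have pos: "G > 0" "P > 0" "Q > 0"
    using sector_norm_ge[of x m d e] sector_norm_ge[of "x(k := x k + 1)" m d e] sector_norm_ge[of "x(k := x k - 1)" m d e] nz m(2)
    unfolding G_def P_def Q_def by linarith+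
  \<comment> \<open>The neighbours may lie in other sectors; the function of the old sector still
    bounds them from above.\<close>
  have "lyapunov d e (x(k := x k + 1)) + lyapunov d e (x(k := x k - 1)) \<le> ln P + ln Q"
    unfolding P_def Q_def using nz md e by (intro add_mono lyapunov_le) blast+
  also have "\<dots> = 2 * ln G + ln (P * Q / G\<^sup>2)"
    using pos by (simp add: ln_mult ln_div ln_realpow)
  also have "ln (P * Q / G\<^sup>2) \<le> P * Q / G\<^sup>2 - 1"
    using pos by (intro ln_le_minus_one) auto
  also have "\<dots> \<le> (G\<^sup>2 + c) / G\<^sup>2 - 1"
    using c pos by (intro diff_right_mono divide_right_mono) (auto simp: G_def P_def Q_def)
  also have "\<dots> = c / G\<^sup>2" using pos by (simp add: field_simps)
  finally show ?thesis by (simp add: lyapunov_def[of d e x] G_def m(1) del: fun_upd_apply)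
qed

text \<open>Up to a positive factor the drift is at most
  \<open>(real d - 1) * C - \<gamma> / 8\<close>, where \<open>C\<close> is the constant of the
  \<open>d - 1\<close> other directions. The bound on \<open>\<gamma>\<close> says that
  \<open>real d * C \<le> \<gamma> / 8\<close>.\<close>

lemma lyapunov_superharmonic:
  assumes e: "0 < e" "32 * (real d)\<^sup>2 * e \<le> 1" and d: "d > 0"
    and \<gamma>: "\<gamma> > 0" "8 * real d * (2 * real d / e + 1 / (4 * e\<^sup>2)) \<le> \<gamma>"
    and x: "\<bar>x (max_index d x)\<bar> \<ge> 2"
  shows "measure_pmf.expectation (walk_kernel d \<gamma> x) (lyapunov d e) \<le> lyapunov d e x"
proof -
  define m where "m = max_index d x"
  define C where "C = 2 * real d / e + 1 / (4 * e\<^sup>2)"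
  define G where "G = sector_norm d e m x"
  define c where "c k = (if k = m then - 1 / 8 else C)" for k
  let ?w = "coord_weight d \<gamma> x"
  let ?D = "\<gamma> + real d - 1"
  have m: "m < d" "\<bar>x m\<bar> \<ge> 2" "\<And>j. j < d \<Longrightarrow> \<bar>x j\<bar> \<le> \<bar>x m\<bar>"
    using max_index(1)[OF d] x abs_le_max_index by (auto simp: m_def)
  have d1: "real d \<ge> 1" using d by simp
  then have "real d * 1 * e \<le> real d * real d * e"
    using e by (intro mult_right_mono mult_left_mono) auto
  then have e2: "2 * real d * e \<le> 1" using e by (simp add: power2_eq_square)
  moreover have "1 * e \<le> real d * e" using d1 e by (intro mult_right_mono) auto
  ultimately have e1: "e \<le> 1" using e by linarith
  have D: "?D > 0" using d1 \<gamma> by linarith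
  have G: "G > 0" using sector_norm_ge[of x m d e] m(2) by (simp add: G_def)
  have C: "C \<ge> 0" using e by (simp add: C_def)
  have w: "?w k \<ge> 0" for k using D \<gamma> by (simp add: coord_weight_def)
  have w1: "(\<Sum>k<d. ?w k) = 1"
  proof -
    have "set_pmf (embed_pmf (coord_weight d \<gamma> x)) \<subseteq> {..<d}"
      using d \<gamma> by (auto simp: set_pmf_eq pmf_coord_weight coord_weight_def split: if_splits)
    then show ?thesis
      using sum_pmf_eq_1[of "{..<d}" "embed_pmf (coord_weight d \<gamma> x)"] d \<gamma>
      by (simp add: pmf_coord_weight)
  qed
  have "lyapunov d e (x(k := x k + 1)) + lyapunov d e (x(k := x k - 1)) \<le> 2 * lyapunov d e x + c k / G\<^sup>2"
    if k: "k < d" for k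
    unfolding G_def
  proof (rule lyapunov_second_difference[OF e(1) e2 k m_def m(2)])
    have "x m \<noteq> 0" using m(2) by auto
    then show "sector_norm d e m (x(k := x k + 1)) * sector_norm d e m (x(k := x k - 1)) \<le> (sector_norm d e m x)\<^sup>2 + c k"
      using sector_norm_max_step[where x=x, OF e m(1) _ m(3)] sector_norm_other_step[where x=x, OF e(1) e1 m(1) _ m(3) k]
      by (auto simp: c_def C_def)
  qed
  then have "(\<Sum>k<d. ?w k * ((lyapunov d e (x(k := x k + 1)) + lyapunov d e (x(k := x k - 1))) / 2)) \<le>
      (\<Sum>k<d. ?w k * (lyapunov d e x + c k / G\<^sup>2 / 2))"
    using w by (intro sum_mono mult_left_mono) (auto simp: field_simps)
  also have "\<dots> = (\<Sum>k<d. ?w k) * lyapunov d e x + (\<Sum>k<d. ?w k * c k) / (2 * G\<^sup>2)"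
    by (simp add: sum_distrib_left sum_divide_distrib sum.distrib algebra_simps)
  also have "(\<Sum>k<d. ?w k * c k) = (\<Sum>k<d. (if k = m then - \<gamma> / 8 else C)) / ?D"
    unfolding sum_divide_distrib by (intro sum.cong) (auto simp: coord_weight_def c_def m_def)
  also have "(\<Sum>k<d. (if k = m then - \<gamma> / 8 else C)) = (real d - 1) * C - \<gamma> / 8"
    using m(1) by (subst sum.remove[of _ m]) (auto simp: of_nat_diff)
  also have "((real d - 1) * C - \<gamma> / 8) / ?D / (2 * G\<^sup>2) \<le> 0"
  proof -
    have "(real d - 1) * C - \<gamma> / 8 \<le> 0"
      using \<gamma>(2) C by (simp add: C_def[symmetric] left_diff_distrib)
    then show ?thesis using D G by (simp add: divide_nonpos_pos)
  qed
  finally show ?thesis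
    using expectation_walk_kernel[OF d \<gamma>(1)] w1 by (simp del: fun_upd_apply)
qed

lemma finite_lyapunov_sublevel:
  assumes "d > 0"
  shows "finite {x \<in> lattice d. lyapunov d e x \<le> c}"
proof (rule finite_subset[OF _ finite_lattice_box])
  show "{x \<in> lattice d. lyapunov d e x \<le> c} \<subseteq> {x \<in> lattice d. \<forall>k<d. \<bar>x k\<bar> \<le> \<lceil>2 * exp c\<rceil>}"
  proof safe
    fix x k assume x: "lyapunov d e x \<le> c" and k: "k < d"
    let ?m = "max_index d x"
    have "\<bar>x ?m\<bar> \<le> 2 * exp c"
    \<comment> \<open>At the origin \<open>ln 0 = 0\<close> carries no information, but the bound is
      trivial there; elsewhere \<open>exp\<close> inverts \<open>ln\<close>.\<close>
    proof (cases "x ?m = 0")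
      case False
      then have "sector_norm d e ?m x > 0" using sector_norm_ge[of x ?m d e] by simp
      then have "sector_norm d e ?m x \<le> exp c"
        using x by (metis lyapunov_def exp_ln exp_le_cancel_iff)
      then show ?thesis using sector_norm_ge[of x ?m d e] by simp
    qed simp
    then show "\<bar>x k\<bar> \<le> \<lceil>2 * exp c\<rceil>"
      using abs_le_max_index[OF k, of x] by linarith
  qed
qed

lemma recurrent_walk:
  assumes e: "0 < e" "32 * (real d)\<^sup>2 * e \<le> 1" and d: "d > 0"
    and \<gamma>: "\<gamma> > 0" "8 * real d * (2 * real d / e + 1 / (4 * e\<^sup>2)) \<le> \<gamma>"
  shows "recurrent_on (lattice d) (walk_kernel d \<gamma>)"
proof -
  interpret locally_finite_chain "lattice d" "walk_kernel d \<gamma>"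
    by unfold_locales (use d \<gamma> in \<open>auto simp: set_pmf_walk_kernel intro: lattice_update\<close>)
  show ?thesis
  proof (rule recurrent_on_Lyapunov)
    \<comment> \<open>Off the box of radius 1 the maximal coordinate has absolute value at least
      2.\<close>
    fix x assume x: "x \<in> lattice d - {x \<in> lattice d. \<forall>k<d. \<bar>x k\<bar> \<le> 1}"
    then obtain k where "k < d" "\<bar>x k\<bar> > 1" by auto
    then show "measure_pmf.expectation (walk_kernel d \<gamma> x) (lyapunov d e) \<le> lyapunov d e x"
      using abs_le_max_index[of k d x] by (intro lyapunov_superharmonic assms) auto
  qed (use walk_irreducible finite_lattice_box finite_lyapunov_sublevel d \<gamma> in auto)
qed

theorem theorem1p5:
  "\<forall>d::nat. d \<ge> 3 \<longrightarrow>
     (\<exists>\<gamma>\<^sub>d::real. \<gamma>\<^sub>d > 0 \<and>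
        (\<forall>\<gamma>\<ge>\<gamma>\<^sub>d. recurrent_on (lattice d) (walk_kernel d \<gamma>)))"
proof (intro allI impI)
  fix d :: nat assume d: "d \<ge> 3"
  \<comment> \<open>The largest \<open>e\<close> with
    \<open>32 * (real d)\<^sup>2 * e \<le> 1\<close>; a smaller one would raise the threshold
    \<open>g\<close>.\<close>
  define e where "e = 1 / (32 * (real d)\<^sup>2)"
  define g where "g = 8 * real d * (2 * real d / e + 1 / (4 * e\<^sup>2))"
  have e: "0 < e" "32 * (real d)\<^sup>2 * e \<le> 1" using d by (auto simp: e_def)
  have "g > 0" using d e by (auto simp: g_def intro!: mult_pos_pos add_pos_pos)
  moreover have "recurrent_on (lattice d) (walk_kernel d \<gamma>)" if "\<gamma> \<ge> g" for \<gamma>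
    using that \<open>g > 0\<close> d unfolding g_def by (intro recurrent_walk[OF e]) auto
  ultimately show "\<exists>\<gamma>\<^sub>d>0. \<forall>\<gamma>\<ge>\<gamma>\<^sub>d. recurrent_on (lattice d) (walk_kernel d \<gamma>)" by blast
qed

end
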